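(* Let $d\ge1$ and $\boldsymbol{p}\in[0,1]^d$. The following hold: (1) The class $\mathcal{B}_d^{\Sigma}(\boldsymbol{p})$ is an antichain in the partially ordered set $(\mathcal{B}_d(\boldsymbol{p}),\preceq_{sm})$. (2) For any $f\in\mathcal{B}_d(\boldsymbol{p})\setminus\mathcal{B}_d^{\Sigma}(\boldsymbol{p})$, either there exists $f^{\Sigma}\in\mathcal{B}_d^{\Sigma}(\boldsymbol{p})$ such that $f^{\Sigma}\preceq_{sm}f$, or $f$ is not comparable under the supermodular order with any $f^{\Sigma}\in\mathcal{B}_d^{\Sigma}(\boldsymbol{p})$.
   Context: $\mathcal{B}_d(\boldsymbol{p})$ is the class of probability mass functions (pmfs) on $\{0,1\}^d$ whose $j$-th one-dimensional marginal is Bernoulli with mean $p_j$, $j=1,\dots,d$. Two real random variables $X,Y$ on a probability space $(\Omega,\mathcal{F},\mathbb{P})$ are countermonotonic if $(X(\omega)-X(\omega'))(Y(\omega)-Y(\omega'))\le 0$ for $(\mathbb{P}\times\mathbb{P})$-almost every $(\omega,\omega')\in\Omega^2$. A Bernoulli random vector $\boldsymbol{I}=(I_1,\dots,I_d)$ (or its pmf) is $\Sigma$-countermonotonic if for every $\Lambda\subseteq\{1,\dots,d\}$ the random variables $\sum_{j\in\Lambda}I_j$ and $\sum_{j\notin\Lambda}I_j$ are countermonotonic (with $\sum_{j\in\varnothing}I_j=0$). $\mathcal{B}_d^{\Sigma}(\boldsymbol{p})$ is the set of $\Sigma$-countermonotonic elements of $\mathcal{B}_d(\boldsymbol{p})$.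 Supermodular order: $\phi:\{0,1\}^d\to\mathbb{R}$ is supermodular if $\phi(\boldsymbol{i})+\phi(\boldsymbol{k})\le\phi(\boldsymbol{i}\wedge\boldsymbol{k})+\phi(\boldsymbol{i}\vee\boldsymbol{k})$ for all $\boldsymbol{i},\boldsymbol{k}$, where $\wedge,\vee$ are componentwise minimum and maximum. For $f,g\in\mathcal{B}_d(\boldsymbol{p})$, $f\preceq_{sm}g$ means $\sum_{\boldsymbol{i}}\phi(\boldsymbol{i})f(\boldsymbol{i})\le\sum_{\boldsymbol{i}}\phi(\boldsymbol{i})g(\boldsymbol{i})$ for all supermodular $\phi$. Two pmfs $f,g$ are comparable if $f\preceq_{sm}g$ or $g\preceq_{sm}f$. An antichain in a partially ordered set is a subset in which no two distinct elements are comparable. *)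

theory Defs
  imports "HOL-Probability.Probability"
begin

text \<open>
  The index set \<open>{1, ..., d}\<close> with \<open>d \<ge> 1\<close> is a finite type \<open>'n\<close>, so \<open>d = CARD('n)\<close>, and
  \<open>{0,1}\<^sup>d\<close> is the type \<open>'n \<Rightarrow> bool\<close>. On this type \<open>inf\<close> and \<open>sup\<close> are the componentwise
  minimum and maximum; \<open>of_bool\<close> turns a coordinate into the number 0 or 1.
\<close>

definition bernoulli_class :: "('n::finite \<Rightarrow> real) \<Rightarrow> ('n \<Rightarrow> bool) pmf set" where
  "bernoulli_class p = {f. \<forall>j. map_pmf (\<lambda>i. i j) f = bernoulli_pmf (p j)}"

definition countermonotonic :: "'a measure \<Rightarrow> ('a \<Rightarrow> real) \<Rightarrow> ('a \<Rightarrow> real) \<Rightarrow> bool" where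
  "countermonotonic M X Y \<longleftrightarrow>
     (AE (w, w') in M \<Otimes>\<^sub>M M. (X w - X w') * (Y w - Y w') \<le> 0)"

definition sigma_countermonotonic :: "'a measure \<Rightarrow> ('a \<Rightarrow> 'n::finite \<Rightarrow> bool) \<Rightarrow> bool" where
  "sigma_countermonotonic M I \<longleftrightarrow>
     (\<forall>\<Lambda>::'n set. countermonotonic M (\<lambda>w. \<Sum>j\<in>\<Lambda>. of_bool (I w j)) (\<lambda>w. \<Sum>j\<in>-\<Lambda>. of_bool (I w j)))"

text \<open>
  A pmf \<open>f\<close> is \<open>\<Sigma>\<close>-countermonotonic if a random vector with law \<open>f\<close> is. We use the canonical one,
  the identity on \<open>{0,1}\<^sup>d\<close> under \<open>f\<close>; the choice is immaterial by the next lemma.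
\<close>

definition sigma_countermonotonic_pmf :: "('n::finite \<Rightarrow> bool) pmf \<Rightarrow> bool" where
  "sigma_countermonotonic_pmf f \<longleftrightarrow> sigma_countermonotonic (measure_pmf f) (\<lambda>i. i)"

lemma sigma_countermonotonic_iff_pmf:
  fixes I :: "'a \<Rightarrow> 'n::finite \<Rightarrow> bool" and f :: "('n \<Rightarrow> bool) pmf"
  assumes "prob_space M" and I[measurable]: "I \<in> measurable M (count_space UNIV)"
    and law: "distr M (count_space UNIV) I = measure_pmf f"
  shows "sigma_countermonotonic M I \<longleftrightarrow> sigma_countermonotonic_pmf f"
proof -
  let ?C = "count_space UNIV :: ('n \<Rightarrow> bool) measure"
  interpret prob_space M by fact
  have sf: "sigma_finite_measure (distr M ?C I)"
    unfolding law by unfold_locales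
  have prod: "measure_pmf f \<Otimes>\<^sub>M measure_pmf f
      = distr (M \<Otimes>\<^sub>M M) (?C \<Otimes>\<^sub>M ?C) (\<lambda>(w, w'). (I w, I w'))"
    using pair_measure_distr[OF I I sf] by (simp add: law)
  have meas: "(\<lambda>(w, w'). (I w, I w')) \<in> measurable (M \<Otimes>\<^sub>M M) (?C \<Otimes>\<^sub>M ?C)"
    by measurable
  have sets: "sets (?C \<Otimes>\<^sub>M ?C) = UNIV"
    by (subst pair_measure_countable) (auto intro: countable_finite)
  show ?thesis
    unfolding sigma_countermonotonic_pmf_def sigma_countermonotonic_def countermonotonic_def prod
    by (subst AE_distr_iff[OF meas]) (simp_all add: sets case_prod_beta)
qed

definition bernoulli_sigma_class :: "('n::finite \<Rightarrow> real) \<Rightarrow> ('n \<Rightarrow> bool) pmf set" where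
  "bernoulli_sigma_class p = {f \<in> bernoulli_class p. sigma_countermonotonic_pmf f}"

definition supermodular :: "(('n::finite \<Rightarrow> bool) \<Rightarrow> real) \<Rightarrow> bool" where
  "supermodular \<phi> \<longleftrightarrow> (\<forall>i k. \<phi> i + \<phi> k \<le> \<phi> (inf i k) + \<phi> (sup i k))"

definition sm_le :: "('n::finite \<Rightarrow> bool) pmf \<Rightarrow> ('n \<Rightarrow> bool) pmf \<Rightarrow> bool"
    (infix "\<preceq>\<^sub>s\<^sub>m" 50) where
  "f \<preceq>\<^sub>s\<^sub>m g \<longleftrightarrow>
     (\<forall>\<phi>. supermodular \<phi> \<longrightarrow> (\<Sum>i\<in>UNIV. \<phi> i * pmf f i) \<le> (\<Sum>i\<in>UNIV. \<phi> i * pmf g i))"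

definition sm_comparable :: "('n::finite \<Rightarrow> bool) pmf \<Rightarrow> ('n \<Rightarrow> bool) pmf \<Rightarrow> bool" where
  "sm_comparable f g \<longleftrightarrow> f \<preceq>\<^sub>s\<^sub>m g \<or> g \<preceq>\<^sub>s\<^sub>m f"

definition sm_order :: "('n::finite \<Rightarrow> real) \<Rightarrow> ('n \<Rightarrow> bool) pmf rel" where
  "sm_order p = {(f, g). f \<in> bernoulli_class p \<and> g \<in> bernoulli_class p \<and> f \<preceq>\<^sub>s\<^sub>m g}"

definition antichain_on :: "'a set \<Rightarrow> 'a rel \<Rightarrow> 'a set \<Rightarrow> bool" where
  "antichain_on P r A \<longleftrightarrow> partial_order_on P r \<and> A \<subseteq> P \<and>
     (\<forall>x\<in>A. \<forall>y\<in>A. x \<noteq> y \<longrightarrow> (x, y) \<notin> r \<and> (y, x) \<notin> r)"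

lemma supermodular_perturbed_square:
  fixes h :: "('n::finite \<Rightarrow> bool) \<Rightarrow> real"
  assumes h: "\<And>i. 0 \<le> h i" "\<And>i. h i \<le> 1"
  shows "supermodular (\<lambda>i. h i + (\<Sum>j\<in>UNIV. of_bool (i j))\<^sup>2)"
  unfolding supermodular_def
proof (intro allI)
  fix i k :: "'n \<Rightarrow> bool"
  let ?S = "\<lambda>i::'n \<Rightarrow> bool. (\<Sum>j\<in>UNIV. of_bool (i j)) :: real"
  show "h i + (?S i)\<^sup>2 + (h k + (?S k)\<^sup>2) \<le> h (inf i k) + (?S (inf i k))\<^sup>2 + (h (sup i k) + (?S (sup i k))\<^sup>2)"
  proof (cases "i \<le> k \<or> k \<le> i")
    case True
    then have "inf i k = i \<and> sup i k = k \<or> inf i k = k \<and> sup i k = i"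
      by (metis inf_absorb1 inf_absorb2 sup_absorb1 sup_absorb2)
    then show ?thesis
    proof (elim disjE conjE)
      assume "inf i k = i" "sup i k = k"
      then show ?thesis by (simp only: order_refl)
    next
      assume "inf i k = k" "sup i k = i"
      then show ?thesis by simp
    qed
  next
    case False
    define u where "u = real (card {j. i j \<and> \<not> k j})"
    define v where "v = real (card {j. k j \<and> \<not> i j})"
    have card: "?S a = real (card {j. a j})" for a
      by simp
    have si: "?S i = ?S (inf i k) + u"
    proof -
      have "card {j. i j} = card {j. i j \<and> k j} + card {j. i j \<and> \<not> k j}"
        by (subst card_Un_disjoint[symmetric]) (auto intro: arg_cong[where f = card])
      then show ?thesis by (simp add: card u_def)
    qed
    have sk: "?S k = ?S (inf i k) + v"
    proof -
      have "card {j. k j} = card {j. i j \<and> k j} + card {j. k j \<and> \<not> i j}"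
        by (subst card_Un_disjoint[symmetric]) (auto intro: arg_cong[where f = card])
      then show ?thesis by (simp add: card v_def)
    qed
    have ss: "?S (sup i k) = ?S (inf i k) + u + v"
    proof -
      have "card {j. i j \<or> k j} = card {j. i j} + card {j. k j \<and> \<not> i j}"
        by (subst card_Un_disjoint[symmetric]) (auto intro: arg_cong[where f = card])
      then have "?S (sup i k) = ?S i + v"
        by (simp only: card sup_apply sup_bool_def v_def of_nat_add)
      with si show ?thesis by simp
    qed
    have "{j. i j \<and> \<not> k j} \<noteq> {}" "{j. k j \<and> \<not> i j} \<noteq> {}"
      using False by (auto simp: le_fun_def)
    then have "u \<ge> 1" "v \<ge> 1"
      unfolding u_def v_def
      by (simp_all add: Suc_le_eq card_gt_0_iff)
    then have uv: "u * v \<ge> 1"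
      using mult_mono[of 1 u 1 v] by simp
    have "(?S (inf i k))\<^sup>2 + (?S (sup i k))\<^sup>2 = (?S i)\<^sup>2 + (?S k)\<^sup>2 + 2 * (u * v)"
      unfolding si sk ss by (simp add: power2_eq_square algebra_simps)
    with uv h[of i] h[of k] h[of "inf i k"] h[of "sup i k"] show ?thesis
      by linarith
  qed
qed

lemma sm_le_antisym:
  fixes f g :: "('n::finite \<Rightarrow> bool) pmf"
  assumes "f \<preceq>\<^sub>s\<^sub>m g" "g \<preceq>\<^sub>s\<^sub>m f"
  shows "f = g"
proof (rule pmf_eqI)
  fix a :: "'n \<Rightarrow> bool"
  let ?S = "\<lambda>i::'n \<Rightarrow> bool. (\<Sum>j\<in>UNIV. of_bool (i j)) :: real"
  let ?E = "\<lambda>f \<phi>. \<Sum>i\<in>UNIV. \<phi> i * pmf f i"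
  have eq: "?E f (\<lambda>i. h i + (?S i)\<^sup>2) = ?E g (\<lambda>i. h i + (?S i)\<^sup>2)"
    if "\<And>i. 0 \<le> h i" "\<And>i. h i \<le> 1" for h :: "('n \<Rightarrow> bool) \<Rightarrow> real"
  proof (rule antisym)
    show "?E f (\<lambda>i. h i + (?S i)\<^sup>2) \<le> ?E g (\<lambda>i. h i + (?S i)\<^sup>2)"
      using assms(1) supermodular_perturbed_square[of h, OF that] unfolding sm_le_def by blast
    show "?E g (\<lambda>i. h i + (?S i)\<^sup>2) \<le> ?E f (\<lambda>i. h i + (?S i)\<^sup>2)"
      using assms(2) supermodular_perturbed_square[of h, OF that] unfolding sm_le_def by blast
  qed
  have split: "?E r (\<lambda>i. of_bool (i = a) + (?S i)\<^sup>2) = pmf r a + ?E r (\<lambda>i. 0 + (?S i)\<^sup>2)" for r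
    by (simp add: distrib_right sum.distrib of_bool_def if_distrib[where f = "\<lambda>x. x * _"]
          sum.delta cong: if_cong)
  have "?E f (\<lambda>i. of_bool (i = a) + (?S i)\<^sup>2) = ?E g (\<lambda>i. of_bool (i = a) + (?S i)\<^sup>2)"
    by (rule eq) auto
  moreover have "?E f (\<lambda>i. 0 + (?S i)\<^sup>2) = ?E g (\<lambda>i. 0 + (?S i)\<^sup>2)"
    by (rule eq) auto
  ultimately show "pmf f a = pmf g a"
    unfolding split by linarith
qed

lemma partial_order_on_sm_order: "partial_order_on (bernoulli_class p) (sm_order p)"
  unfolding partial_order_on_def preorder_on_def
proof (intro conjI)
  show "sm_order p \<subseteq> bernoulli_class p \<times> bernoulli_class p"
    by (auto simp: sm_order_def)
  show "refl_on (bernoulli_class p) (sm_order p)"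
    by (auto simp: refl_on_def sm_order_def sm_le_def)
  show "trans (sm_order p)"
    unfolding trans_def sm_order_def sm_le_def by (auto intro: order_trans)
  show "antisym (sm_order p)"
    by (auto simp: antisym_def sm_order_def intro: sm_le_antisym)
qed

end

theory Submission
  imports Defs
begin

text \<open>
  Everything follows from the fact that a \<open>\<Sigma>\<close>-countermonotonic pmf \<open>g\<close> is minimal for the
  supermodular order: \<open>f \<preceq>\<^sub>s\<^sub>m g\<close> forces \<open>f = g\<close>. Two distinct elements of the class are then never
  ordered, which is (1); and if \<open>f\<close> outside the class is comparable to some member, then that member
  must lie below \<open>f\<close>, which is (2).

  For minimality, testing countermonotonicity on the singletons \<open>\<Lambda> = {j}\<close> already shows that the
  coordinate sum \<open>S\<close> takes at most two values on the support of \<open>g\<close>, and that these are of the form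
  \<open>m\<close> and \<open>m + 1\<close> (lemma \<open>sigma_countermonotonic_pmf_two_layers\<close>). The function
  \<open>q = (S - m) (S - (m + 1))\<close> is nonnegative and vanishes on these two layers. It is also so strictly
  supermodular on incomparable pairs that adding the indicator of any single point \<open>a\<close> preserves
  supermodularity. Testing \<open>f \<preceq>\<^sub>s\<^sub>m g\<close> on \<open>1\<^sub>a + q\<close> therefore gives \<open>f a \<le> f a + E\<^sub>f q \<le> g a\<close> for
  every \<open>a\<close>, and two pmfs ordered pointwise coincide.
\<close>

text \<open>
  If \<open>i\<close> had at least two ones more than \<open>k\<close>, some coordinate \<open>j\<close> would be 1 in \<open>i\<close> and 0 in \<open>k\<close>.
  Splitting off \<open>j\<close> leaves the rest of \<open>i\<close> still strictly larger than the rest of \<open>k\<close>, so both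
  partial sums would move in the same direction.
\<close>
lemma sigma_countermonotonic_pmf_card_le:
  fixes g :: "('n::finite \<Rightarrow> bool) pmf"
  assumes g: "sigma_countermonotonic_pmf g" and i: "i \<in> set_pmf g" and k: "k \<in> set_pmf g"
  shows "card {j. i j} \<le> card {j. k j} + 1"
proof (rule ccontr)
  assume large: "\<not> card {j. i j} \<le> card {j. k j} + 1"
  have "\<not> {j. i j} \<subseteq> {j. k j}"
    using large card_mono[of "{j. k j}" "{j. i j}"] by auto
  then obtain j where j: "i j" "\<not> k j"
    by auto
  let ?X = "\<lambda>w::'n \<Rightarrow> bool. (\<Sum>l\<in>{j}. of_bool (w l)) :: real"
  let ?Y = "\<lambda>w::'n \<Rightarrow> bool. (\<Sum>l\<in>-{j}. of_bool (w l)) :: real"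
  have cm: "AE (w, w') in measure_pmf g \<Otimes>\<^sub>M measure_pmf g. (?X w - ?X w') * (?Y w - ?Y w') \<le> 0"
    using g unfolding sigma_countermonotonic_pmf_def sigma_countermonotonic_def countermonotonic_def
    by blast
  interpret pair_sigma_finite "measure_pmf g" "measure_pmf g"
    by unfold_locales
  have "AE w in measure_pmf g. AE w' in measure_pmf g. (?X w - ?X w') * (?Y w - ?Y w') \<le> 0"
    using AE_pair[OF cm] by simp
  then have le: "(?X i - ?X k) * (?Y i - ?Y k) \<le> 0"
    using i k unfolding AE_measure_pmf_iff by blast
  have Y: "?Y w = real (card {l. w l}) - of_bool (w j)" for w
  proof -
    have "(\<Sum>l\<in>UNIV. of_bool (w l)) = of_bool (w j) + ?Y w"
      by (simp add: sum.remove[of UNIV j] Compl_eq_Diff_UNIV del: sum_of_bool_eq)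
    then show ?thesis
      by simp
  qed
  show False
    using le large unfolding Y using j by simp
qed

lemma sigma_countermonotonic_pmf_two_layers:
  fixes g :: "('n::finite \<Rightarrow> bool) pmf"
  assumes "sigma_countermonotonic_pmf g"
  obtains m where "\<And>i. i \<in> set_pmf g \<Longrightarrow> card {j. i j} = m \<or> card {j. i j} = m + 1"
proof -
  obtain k where k: "k \<in> set_pmf g"
    and least: "\<And>i. i \<in> set_pmf g \<Longrightarrow> card {j. k j} \<le> card {j. i j}"
    using ex_has_least_nat[of "\<lambda>i. i \<in> set_pmf g" _ "\<lambda>i. card {j. i j}"] set_pmf_not_empty[of g]
    by blast
  show thesis
  proof (rule that)
    fix i assume i: "i \<in> set_pmf g"
    show "card {j. i j} = card {j. k j} \<or> card {j. i j} = card {j. k j} + 1"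
      using least[OF i] sigma_countermonotonic_pmf_card_le[OF assms i k] by linarith
  qed
qed

text \<open>
  The quadratic differs from the square of the coordinate sum by a modular function, and the
  square alone compensates for any perturbation with values in the unit interval.
\<close>
lemma supermodular_perturbed_layer_quadratic:
  fixes h :: "('n::finite \<Rightarrow> bool) \<Rightarrow> real" and m :: real
  assumes "\<And>i. 0 \<le> h i" "\<And>i. h i \<le> 1"
  shows "supermodular (\<lambda>i. h i + (real (card {j. i j}) - m) * (real (card {j. i j}) - (m + 1)))"
proof -
  let ?S = "\<lambda>i::'n \<Rightarrow> bool. real (card {j. i j})"
  have modular: "?S (inf i k) + ?S (sup i k) = ?S i + ?S k" for i k
  proof -
    have "card ({j. i j} \<union> {j. k j}) + card ({j. i j} \<inter> {j. k j}) = card {j. i j} + card {j. k j}"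
      using card_Un_Int[of "{j. i j}" "{j. k j}"] by simp
    then show ?thesis
      by (simp add: Collect_disj_eq Collect_conj_eq flip: of_nat_add)
  qed
  show ?thesis
    unfolding supermodular_def
  proof (intro allI)
    fix i k :: "'n \<Rightarrow> bool"
    have square: "h i + (?S i)\<^sup>2 + (h k + (?S k)\<^sup>2)
        \<le> h (inf i k) + (?S (inf i k))\<^sup>2 + (h (sup i k) + (?S (sup i k))\<^sup>2)"
      using supermodular_perturbed_square[of h, OF assms]
      unfolding supermodular_def by (simp del: sup_apply inf_apply)
    have expand: "(s - m) * (s - (m + 1)) = s\<^sup>2 - (2 * m + 1) * s + m * (m + 1)" for s :: real
      by (simp add: power2_eq_square algebra_simps)
    have linear: "(2 * m + 1) * ?S (inf i k) + (2 * m + 1) * ?S (sup i k)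
        = (2 * m + 1) * ?S i + (2 * m + 1) * ?S k"
      using modular[of i k] by (simp only: flip: distrib_left)
    show "h i + (?S i - m) * (?S i - (m + 1)) + (h k + (?S k - m) * (?S k - (m + 1)))
        \<le> h (inf i k) + (?S (inf i k) - m) * (?S (inf i k) - (m + 1)) +
          (h (sup i k) + (?S (sup i k) - m) * (?S (sup i k) - (m + 1)))"
      unfolding expand using square linear by linarith
  qed
qed

lemma sigma_countermonotonic_pmf_minimal:
  fixes f g :: "('n::finite \<Rightarrow> bool) pmf"
  assumes g: "sigma_countermonotonic_pmf g" and le: "f \<preceq>\<^sub>s\<^sub>m g"
  shows "f = g"
proof -
  obtain m where m: "\<And>i. i \<in> set_pmf g \<Longrightarrow> card {j. i j} = m \<or> card {j. i j} = m + 1"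
    using sigma_countermonotonic_pmf_two_layers[OF g] by blast
  define q where "q i = (real (card {j. i j}) - real m) * (real (card {j. i j}) - (real m + 1))"
    for i :: "'n \<Rightarrow> bool"
  \<comment> \<open>No integer lies strictly between the two roots.\<close>
  have q_nonneg: "0 \<le> q i" for i
  proof (cases "card {j. i j} \<le> m")
    case True
    then show ?thesis
      unfolding q_def by (intro mult_nonpos_nonpos) auto
  next
    case False
    then show ?thesis
      unfolding q_def by (intro mult_nonneg_nonneg) auto
  qed
  have q_null: "q i * pmf g i = 0" for i
    using m[of i] by (cases "i \<in> set_pmf g") (auto simp: q_def set_pmf_iff)
  have split: "(\<Sum>i\<in>UNIV. (of_bool (i = a) + q i) * pmf r i)
      = pmf r a + (\<Sum>i\<in>UNIV. q i * pmf r i)" for a and r :: "('n \<Rightarrow> bool) pmf"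
    by (simp add: distrib_right sum.distrib of_bool_def if_distrib[where f = "\<lambda>x. x * _"]
        sum.delta cong: if_cong)
  have "pmf f a \<le> pmf g a" for a
  proof -
    have "supermodular (\<lambda>i. of_bool (i = a) + q i)"
      unfolding q_def by (rule supermodular_perturbed_layer_quadratic) auto
    then have "pmf f a + (\<Sum>i\<in>UNIV. q i * pmf f i) \<le> pmf g a + (\<Sum>i\<in>UNIV. q i * pmf g i)"
      using le unfolding sm_le_def split[symmetric] by blast
    moreover have "0 \<le> (\<Sum>i\<in>UNIV. q i * pmf f i)"
      by (intro sum_nonneg mult_nonneg_nonneg q_nonneg pmf_nonneg)
    ultimately show ?thesis
      by (simp add: q_null)
  qed
  then show ?thesis
    using pmf_neq_exists_less[of g f] by (metis not_less)
qed

theorem theorem5p1: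
  fixes p :: "'n::finite \<Rightarrow> real"
  assumes "\<forall>j. 0 \<le> p j \<and> p j \<le> 1"
  shows "antichain_on (bernoulli_class p) (sm_order p) (bernoulli_sigma_class p) \<and>
    (\<forall>f \<in> bernoulli_class p - bernoulli_sigma_class p.
       (\<exists>f\<^sub>\<Sigma> \<in> bernoulli_sigma_class p. f\<^sub>\<Sigma> \<preceq>\<^sub>s\<^sub>m f) \<or>
       (\<forall>f\<^sub>\<Sigma> \<in> bernoulli_sigma_class p. \<not> sm_comparable f f\<^sub>\<Sigma>))"
proof -
  have minimal: "f = g" if "g \<in> bernoulli_sigma_class p" "f \<preceq>\<^sub>s\<^sub>m g" for f g
    using that sigma_countermonotonic_pmf_minimal unfolding bernoulli_sigma_class_def by blast
  have "antichain_on (bernoulli_class p) (sm_order p) (bernoulli_sigma_class p)"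
    unfolding antichain_on_def
  proof (intro conjI ballI impI)
    show "bernoulli_sigma_class p \<subseteq> bernoulli_class p"
      by (auto simp: bernoulli_sigma_class_def)
  qed (use partial_order_on_sm_order minimal in \<open>auto simp: sm_order_def\<close>)
  then show ?thesis
    using minimal unfolding sm_comparable_def by blast
qed

end
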